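(* Let $d_1,d_2,\alpha,\beta$ be integers with $0\le\alpha<d_1$ and $0\le\beta<d_2$, and let $\mathcal{T}$ be a regular T-mesh without holes and with no vanished l-edges. Then $\mathcal{T}$ is diagonalizable (for the parameters $d_1,d_2,\alpha,\beta$) if and only if for every nonempty set $\mathbb{S}$ of interior l-edges of $\mathcal{T}$ at least one of the following holds: (i) there exists a horizontal l-edge in $\mathbb{S}$ such that the number of vertices on this l-edge which are not on any other l-edge in $\mathbb{S}$ is at least $N^h$; or (ii) there exists a vertical l-edge in $\mathbb{S}$ such that the number of vertices on this l-edge which are not on any other l-edge in $\mathbb{S}$ is at least $N^v$. Here $N^h$ is the least integer $\ge \frac{d_1+1}{d_1-\alpha}$ and $N^v$ is the least integer $\ge\frac{d_2+1}{d_2-\beta}$.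
   Context: **T-meshes.** A T-mesh $\mathcal{T}$ is a finite collection of axis-aligned closed rectangles $F_i$ (faces, cells) in $\mathbb{R}^2$ with union the domain $\Omega$, such that distinct rectangles intersect only at points on their edges. The vertices of the rectangles are the vertices of $\mathcal{T}$; the line segment connecting two adjacent vertices on a grid line is an edge of $\mathcal{T}$. A T-junction is a vertex of one rectangle lying in the interior of a side of another rectangle. $\Omega$ need not be rectangular. $\mathcal{T}$ is regular if for each vertex the set of all rectangles containing it has connected interior. $\mathcal{T}$ is without holes if the (connected) domain $\Omega$ has no holes. A vertex is a boundary vertex if it lies on the boundary of $\Omega$, and an interior vertex otherwise. An edge lying on the boundary of $\Omega$ is a boundary edge; other edges are interior edges. **l-edges.** An l-edge is a maximal line segment composed of connected (collinear) interior edges; its two end points are T-junctions or boundary vertices. It is an interior l-edge if both end points are interior vertices. The vertices on an l-edge are all mesh vertices lying on it, including its end points. A horizontal (resp. vertical) interior l-edge is vanished if the number of vertices on it is less than $N^h$ (resp. $N^v$). **Diagonalizable.** Let $n_e$ be the number of interior l-edges. For an ordering $e_1,\dots,e_{n_e}$ of all interior l-edges, the new-vertex-vector $\nu$ is defined by: $\nu_1$ is the number of vertices on $e_1$, and $\nu_j$ is the number of vertices on $e_j$ that are not on any $e_k$ with $k<j$. $\mathcal{T}$ is diagonalizable if there is an ordering of all its interior l-edges such that, for every $j$, $\nu_j\ge N^h$ if $e_j$ is horizontal and $\nu_j\ge N^v$ if $e_j$ is vertical. *)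

theory Defs
  imports "HOL-Analysis.Analysis"
begin

type_synonym point = "real \<times> real"

definition is_rectangle :: "point set \<Rightarrow> bool" where
  "is_rectangle F \<longleftrightarrow> (\<exists>a b c d. a < b \<and> c < d \<and> F = {a..b} \<times> {c..d})"

definition corners :: "point set \<Rightarrow> point set" where
  "corners F = {p. \<exists>a b c d. a < b \<and> c < d \<and> F = {a..b} \<times> {c..d} \<and> p \<in> {a, b} \<times> {c, d}}"

definition sides :: "point set \<Rightarrow> point set set" where
  "sides F = {s. \<exists>a b c d. a < b \<and> c < d \<and> F = {a..b} \<times> {c..d} \<and>
     s \<in> {{a..b} \<times> {c}, {a..b} \<times> {d}, {a} \<times> {c..d}, {b} \<times> {c..d}}}"

definition T_mesh :: "point set set \<Rightarrow> bool" where
  "T_mesh T \<longleftrightarrow> finite T \<and> (\<forall>F\<in>T. is_rectangle F) \<and>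
     (\<forall>F\<in>T. \<forall>G\<in>T. F \<noteq> G \<longrightarrow> F \<inter> G \<subseteq> \<Union>(sides F) \<inter> \<Union>(sides G))"

definition domain :: "point set set \<Rightarrow> point set" where
  "domain T = \<Union>T"

definition vertices :: "point set set \<Rightarrow> point set" where
  "vertices T = (\<Union>F\<in>T. corners F)"

text \<open>The union of all grid lines of the mesh.\<close>

definition skeleton :: "point set set \<Rightarrow> point set" where
  "skeleton T = (\<Union>F\<in>T. \<Union>(sides F))"

definition horizontal :: "point set \<Rightarrow> bool" where
  "horizontal s \<longleftrightarrow> (\<forall>x\<in>s. \<forall>y\<in>s. snd x = snd y)"

definition vertical :: "point set \<Rightarrow> bool" where
  "vertical s \<longleftrightarrow> (\<forall>x\<in>s. \<forall>y\<in>s. fst x = fst y)"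

definition edges :: "point set set \<Rightarrow> point set set" where
  "edges T = {closed_segment v w | v w. v \<in> vertices T \<and> w \<in> vertices T \<and> v \<noteq> w \<and>
     (horizontal (closed_segment v w) \<or> vertical (closed_segment v w)) \<and>
     closed_segment v w \<subseteq> skeleton T \<and> open_segment v w \<inter> vertices T = {}}"

definition T_junction :: "point set set \<Rightarrow> point \<Rightarrow> bool" where
  "T_junction T p \<longleftrightarrow> (\<exists>F\<in>T. \<exists>G\<in>T. F \<noteq> G \<and> p \<in> corners F \<and> (\<exists>s\<in>sides G. p \<in> rel_interior s))"

definition regular_mesh :: "point set set \<Rightarrow> bool" where
  "regular_mesh T \<longleftrightarrow> (\<forall>v\<in>vertices T. connected (interior (\<Union>{F\<in>T. v \<in> F})))"

text \<open>A hole of the domain is a bounded component of its complement; \<^const>\<open>inside\<close> is the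
  union of these components.\<close>

definition without_holes :: "point set set \<Rightarrow> bool" where
  "without_holes T \<longleftrightarrow> connected (domain T) \<and> inside (domain T) = {}"

definition boundary_vertices :: "point set set \<Rightarrow> point set" where
  "boundary_vertices T = vertices T \<inter> frontier (domain T)"

definition interior_vertices :: "point set set \<Rightarrow> point set" where
  "interior_vertices T = vertices T - boundary_vertices T"

definition boundary_edges :: "point set set \<Rightarrow> point set set" where
  "boundary_edges T = {e \<in> edges T. e \<subseteq> frontier (domain T)}"

definition interior_edges :: "point set set \<Rightarrow> point set set" where
  "interior_edges T = edges T - boundary_edges T"

text \<open>A line segment that is a union of interior edges. Since the union is required to be a
  segment, these edges are automatically collinear and connected.\<close>

definition interior_edge_segment :: "point set set \<Rightarrow> point set \<Rightarrow> bool" where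
  "interior_edge_segment T s \<longleftrightarrow>
     (\<exists>p q. s = closed_segment p q) \<and> (\<exists>E\<subseteq>interior_edges T. s = \<Union>E)"

text \<open>The condition on the end points is part of the usual definition, although for a T-mesh it
  already follows from maximality.\<close>

definition l_edges :: "point set set \<Rightarrow> point set set" where
  "l_edges T = {s. interior_edge_segment T s \<and>
     (\<forall>s'. interior_edge_segment T s' \<and> s \<subseteq> s' \<longrightarrow> s' = s) \<and>
     (\<exists>p q. s = closed_segment p q \<and>
        (\<forall>x\<in>{p, q}. T_junction T x \<or> x \<in> boundary_vertices T))}"

definition interior_l_edges :: "point set set \<Rightarrow> point set set" where
  "interior_l_edges T = {s \<in> l_edges T.
     \<exists>p q. s = closed_segment p q \<and> p \<in> interior_vertices T \<and> q \<in> interior_vertices T}"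

definition N_h :: "int \<Rightarrow> int \<Rightarrow> int" where
  "N_h d1 \<alpha> = \<lceil>real_of_int (d1 + 1) / real_of_int (d1 - \<alpha>)\<rceil>"

definition N_v :: "int \<Rightarrow> int \<Rightarrow> int" where
  "N_v d2 \<beta> = \<lceil>real_of_int (d2 + 1) / real_of_int (d2 - \<beta>)\<rceil>"

definition vanished :: "int \<Rightarrow> int \<Rightarrow> int \<Rightarrow> int \<Rightarrow> point set set \<Rightarrow> point set \<Rightarrow> bool" where
  "vanished d1 d2 \<alpha> \<beta> T e \<longleftrightarrow> e \<in> interior_l_edges T \<and>
     (horizontal e \<and> int (card (vertices T \<inter> e)) < N_h d1 \<alpha> \<or>
      vertical e \<and> int (card (vertices T \<inter> e)) < N_v d2 \<beta>)"

text \<open>The entries of the new-vertex-vector, indexed from \<open>0\<close>, for an ordering given as a list.\<close>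

definition new_vertices :: "point set set \<Rightarrow> point set list \<Rightarrow> nat \<Rightarrow> nat" where
  "new_vertices T es j = card {v \<in> vertices T. v \<in> es ! j \<and> (\<forall>k<j. v \<notin> es ! k)}"

definition diagonalizable :: "int \<Rightarrow> int \<Rightarrow> int \<Rightarrow> int \<Rightarrow> point set set \<Rightarrow> bool" where
  "diagonalizable d1 d2 \<alpha> \<beta> T \<longleftrightarrow>
     (\<exists>es. distinct es \<and> set es = interior_l_edges T \<and>
        (\<forall>j<length es.
           (horizontal (es ! j) \<longrightarrow> int (new_vertices T es j) \<ge> N_h d1 \<alpha>) \<and>
           (vertical (es ! j) \<longrightarrow> int (new_vertices T es j) \<ge> N_v d2 \<beta>)))"

definition private_vertices :: "point set set \<Rightarrow> point set set \<Rightarrow> point set \<Rightarrow> point set" where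
  "private_vertices T S e = {v \<in> vertices T. v \<in> e \<and> (\<forall>e'\<in>S. e' \<noteq> e \<longrightarrow> v \<notin> e')}"

end

theory Submission
  imports Defs
begin

text \<open>In one direction, the private vertices of an l-edge that comes last in \<open>S\<close> with respect to
  the given ordering include all its new vertices. In the other direction, the ordering is built
  from the end: an l-edge of \<open>S\<close> with enough private vertices is put last, and the process
  continues with the rest of \<open>S\<close>.\<close>

lemma finite_corners: "is_rectangle F \<Longrightarrow> finite (corners F)"
proof -
  assume "is_rectangle F"
  then obtain a b c d where F: "a < b" "c < d" "F = {a..b} \<times> {c..d}"
    unfolding is_rectangle_def by blast
  \<comment> \<open>\<open>corners\<close> ranges over every way of writing \<open>F\<close> as a
    product of intervals; nondegenerate intervals determine their end points, so there is only
    one.\<close>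
  have "corners F \<subseteq> {a, b} \<times> {c, d}"
    unfolding corners_def F(3) using F(1,2)
    by (auto simp: times_eq_iff Icc_eq_Icc)
  then show ?thesis
    by (rule finite_subset) simp
qed

lemma finite_vertices: "T_mesh T \<Longrightarrow> finite (vertices T)"
  by (auto simp: T_mesh_def vertices_def finite_corners)

lemma finite_edges:
  assumes "T_mesh T"
  shows "finite (edges T)"
proof (rule finite_subset)
  show "edges T \<subseteq> (\<lambda>(v, w). closed_segment v w) ` (vertices T \<times> vertices T)"
    unfolding edges_def by auto
qed (use finite_vertices[OF assms] in simp)

text \<open>Each l-edge is the union of some set of edges, and finitely many edges have finitely
  many subsets.\<close>

lemma finite_interior_l_edges:
  assumes "T_mesh T"
  shows "finite (interior_l_edges T)"
proof (rule finite_subset)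
  show "interior_l_edges T \<subseteq> \<Union> ` Pow (edges T)"
  proof
    fix s assume "s \<in> interior_l_edges T"
    then have "interior_edge_segment T s"
      by (simp add: interior_l_edges_def l_edges_def)
    then obtain E where "E \<subseteq> interior_edges T" "s = \<Union>E"
      unfolding interior_edge_segment_def by metis
    then show "s \<in> \<Union> ` Pow (edges T)"
      by (auto simp: interior_edges_def)
  qed
qed (use finite_edges[OF assms] in simp)

text \<open>In the parameter of the segment, \<open>f\<close> is affine; equal values at two
  distinct parameters force slope zero. Applied to \<open>fst\<close> and \<open>snd\<close>, this
  carries the direction of one edge over to the whole l-edge.\<close>

lemma linear_eq_on_subsegment:
  fixes f :: "'a::real_vector \<Rightarrow> real"
  assumes "linear f" "v \<in> closed_segment p q" "w \<in> closed_segment p q" "v \<noteq> w" "f v = f w"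
  shows "\<forall>x\<in>closed_segment p q. \<forall>y\<in>closed_segment p q. f x = f y"
proof -
  have f: "f ((1 - u) *\<^sub>R p + u *\<^sub>R q) = f p + u * (f q - f p)" for u
    by (simp only: linear_add[OF assms(1)] linear_scale[OF assms(1)]) (simp add: algebra_simps)
  obtain a b where ab: "v = (1 - a) *\<^sub>R p + a *\<^sub>R q" "w = (1 - b) *\<^sub>R p + b *\<^sub>R q"
    using assms(2,3) by (auto simp: in_segment)
  then have "a \<noteq> b"
    using assms(4) by blast
  with assms(5) have "f q = f p"
    unfolding ab f by simp
  then show ?thesis
    by (auto simp: in_segment f)
qed

text \<open>An l-edge is defined merely as a segment, but it contains an edge, which is
  axis-parallel and has two distinct end points.\<close>

lemma interior_l_edge_direction:
  assumes "s \<in> interior_l_edges T"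
  shows "horizontal s \<longleftrightarrow> \<not> vertical s"
proof -
  have "interior_edge_segment T s"
    using assms by (simp add: interior_l_edges_def l_edges_def)
  then obtain p q E where s: "s = closed_segment p q" and E: "E \<subseteq> interior_edges T" "s = \<Union>E"
    unfolding interior_edge_segment_def by metis
  \<comment> \<open>This rules out \<open>E = {}\<close>: a segment contains its end point.\<close>
  have "p \<in> \<Union>E"
    unfolding E(2)[symmetric] s by simp
  then obtain e where "e \<in> E"
    by blast
  then have "e \<in> edges T"
    using E(1) by (auto simp: interior_edges_def)
  then obtain v w where vw: "e = closed_segment v w" "v \<noteq> w" "horizontal e \<or> vertical e"
    unfolding edges_def mem_Collect_eq by metis
  then have in_e: "v \<in> e" "w \<in> e"
    by auto
  then have in_s: "v \<in> s" "w \<in> s"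
    using \<open>e \<in> E\<close> E(2) by blast+
  have "fst v = fst w \<or> snd v = snd w"
    using vw(3) in_e unfolding horizontal_def vertical_def by metis
  then have "horizontal s \<or> vertical s"
    using linear_eq_on_subsegment[OF linear_fst in_s[unfolded s] vw(2)]
      linear_eq_on_subsegment[OF linear_snd in_s[unfolded s] vw(2)]
    unfolding s horizontal_def vertical_def by argo
  moreover have "\<not> (horizontal s \<and> vertical s)"
    using in_s vw(2) prod_eqI[of v w] unfolding horizontal_def vertical_def by metis
  ultimately show ?thesis
    by blast
qed

lemma new_vertices_append:
  "j < length es \<Longrightarrow> new_vertices T (es @ [e]) j = new_vertices T es j"
  by (auto simp: new_vertices_def nth_append intro!: arg_cong[where f = card])

text \<open>All other members stand before the last one, so being new to it and being private to it
  coincide. If \<open>e\<close> also occurred earlier, the entry would be 0.\<close>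

lemma new_vertices_last:
  assumes "e \<notin> set es"
  shows "new_vertices T (es @ [e]) (length es) = card (private_vertices T (insert e (set es)) e)"
proof -
  have "(\<forall>k<length es. v \<notin> (es @ [e]) ! k) \<longleftrightarrow> (\<forall>e'\<in>insert e (set es). e' \<noteq> e \<longrightarrow> v \<notin> e')" for v
    using assms by (auto simp: nth_append all_set_conv_all_nth)
  then show ?thesis
    by (simp add: new_vertices_def private_vertices_def)
qed

text \<open>Any member of \<open>S\<close> other than \<open>es ! j\<close> stands before position
  \<open>j\<close>, so it cannot contain a vertex that is new at \<open>j\<close>.\<close>

lemma new_vertices_le_private:
  assumes "finite (vertices T)" "S \<subseteq> set es" "\<And>k. k < length es \<Longrightarrow> es ! k \<in> S \<Longrightarrow> k \<le> j"
  shows "new_vertices T es j \<le> card (private_vertices T S (es ! j))"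
  unfolding new_vertices_def private_vertices_def
proof (rule card_mono)
  have "v \<notin> e'" if v: "\<forall>k<j. v \<notin> es ! k" and e': "e' \<in> S" "e' \<noteq> es ! j" for v e'
  proof -
    obtain k where k: "k < length es" "es ! k = e'"
      using e'(1) assms(2) by (metis in_set_conv_nth subsetD)
    then have "k < j"
      using assms(3)[of k] e' by (cases "k = j") auto
    then show ?thesis
      using v k(2) by blast
  qed
  then show "{v \<in> vertices T. v \<in> es ! j \<and> (\<forall>k<j. v \<notin> es ! k)}
    \<subseteq> {v \<in> vertices T. v \<in> es ! j \<and> (\<forall>e'\<in>S. e' \<noteq> es ! j \<longrightarrow> v \<notin> e')}"
    by blast
qed (use assms(1) in simp)

text \<open>A single threshold function \<open>N\<close> replaces the two directions, and
  \<open>L\<close> is an arbitrary finite set so that members can be removed in an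
  induction.\<close>

lemma ordering_iff_private:
  fixes N :: "point set \<Rightarrow> int"
  assumes "finite (vertices T)" "finite L"
  shows "(\<exists>es. distinct es \<and> set es = L \<and> (\<forall>j<length es. N (es ! j) \<le> int (new_vertices T es j)))
    \<longleftrightarrow> (\<forall>S. S \<subseteq> L \<and> S \<noteq> {} \<longrightarrow> (\<exists>e\<in>S. N e \<le> int (card (private_vertices T S e))))"
    (is "?ordering L \<longleftrightarrow> ?private L")
proof
  assume "?ordering L"
  then obtain es where es: "set es = L" "\<forall>j<length es. N (es ! j) \<le> int (new_vertices T es j)"
    by blast
  show "?private L"
  proof (intro allI impI)
    fix S assume S: "S \<subseteq> L \<and> S \<noteq> {}"
    \<comment> \<open>The positions of the members of \<open>S\<close>; the largest one supplies the
      witness \<open>es ! Max J\<close>.\<close>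
    define J where "J = {j. j < length es \<and> es ! j \<in> S}"
    obtain e where "e \<in> S" "e \<in> set es"
      using S es(1) by blast
    then have "finite J" "J \<noteq> {}"
      by (auto simp: J_def in_set_conv_nth)
    then have max: "Max J \<in> J" "\<And>k. k \<in> J \<Longrightarrow> k \<le> Max J"
      by simp_all
    have "new_vertices T es (Max J) \<le> card (private_vertices T S (es ! Max J))"
      using S es(1) max(2) by (intro new_vertices_le_private assms(1)) (auto simp: J_def)
    then show "\<exists>e\<in>S. N e \<le> int (card (private_vertices T S e))"
      using max(1) es(2) by (force simp: J_def)
  qed
next
  assume "?private L"
  with assms(2) show "?ordering L"
  proof (induction L rule: finite_psubset_induct)
    case (psubset L)
    \<comment> \<open>For \<open>L = {}\<close> the empty list serves; the closing
      \<open>simp\<close> settles that case.\<close>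
    show ?case
    proof (cases "L = {}")
      case False
      then obtain e where e: "e \<in> L" "N e \<le> int (card (private_vertices T L e))"
        using psubset.prems by blast
      \<comment> \<open>The condition passes to subsets, since it speaks of all nonempty subsets of
        \<open>L\<close>.\<close>
      have "?private (L - {e})"
        using psubset.prems by blast
      then obtain es where es: "distinct es" "set es = L - {e}"
        "\<forall>j<length es. N (es ! j) \<le> int (new_vertices T es j)"
        using psubset.IH[of "L - {e}"] e(1) by blast
      have L: "insert e (set es) = L" "e \<notin> set es"
        using es(2) e(1) by auto
      \<comment> \<open>An entry depends only on the list up to its own position, so appending
        \<open>e\<close> keeps the old entries; the new one counts the vertices private to
        \<open>e\<close> within all of \<open>L\<close>.\<close>
      have "N ((es @ [e]) ! j) \<le> int (new_vertices T (es @ [e]) j)"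
        if "j < length (es @ [e])" for j
      proof (cases "j < length es")
        case True
        then show ?thesis
          using es(3) by (simp add: new_vertices_append nth_append)
      next
        case False
        with that have "j = length es"
          by simp
        then show ?thesis
          using e(2) L by (simp add: new_vertices_last)
      qed
      then show ?thesis
        using es(1) L by (intro exI[of _ "es @ [e]"]) auto
    qed simp
  qed
qed

theorem lemma4p6:
  fixes d1 d2 \<alpha> \<beta> :: int and T :: "(real \<times> real) set set"
  assumes "0 \<le> \<alpha>" and "\<alpha> < d1" and "0 \<le> \<beta>" and "\<beta> < d2"
    and "T_mesh T" and "regular_mesh T" and "without_holes T"
    and "\<forall>e\<in>interior_l_edges T. \<not> vanished d1 d2 \<alpha> \<beta> T e"
  shows "diagonalizable d1 d2 \<alpha> \<beta> T \<longleftrightarrow>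
    (\<forall>S. S \<subseteq> interior_l_edges T \<and> S \<noteq> {} \<longrightarrow>
       (\<exists>e\<in>S. horizontal e \<and> int (card (private_vertices T S e)) \<ge> N_h d1 \<alpha>) \<or>
       (\<exists>e\<in>S. vertical e \<and> int (card (private_vertices T S e)) \<ge> N_v d2 \<beta>))"
proof -
  let ?L = "interior_l_edges T"
  define N where "N e = (if horizontal e then N_h d1 \<alpha> else N_v d2 \<beta>)" for e
  \<comment> \<open>Exactly one direction holds for each member of \<open>?L\<close>. Hence the two
    implications in \<open>diagonalizable\<close> and the two alternatives (i), (ii) reduce to the
    same inequality.\<close>
  have N: "(horizontal e \<longrightarrow> N_h d1 \<alpha> \<le> n) \<and> (vertical e \<longrightarrow> N_v d2 \<beta> \<le> n) \<longleftrightarrow> N e \<le> n"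
    "horizontal e \<and> N_h d1 \<alpha> \<le> n \<or> vertical e \<and> N_v d2 \<beta> \<le> n \<longleftrightarrow> N e \<le> n"
    if "e \<in> ?L" for e n
    using interior_l_edge_direction[OF that] by (auto simp: N_def)
  have "diagonalizable d1 d2 \<alpha> \<beta> T \<longleftrightarrow>
    (\<exists>es. distinct es \<and> set es = ?L \<and> (\<forall>j<length es. N (es ! j) \<le> int (new_vertices T es j)))"
    unfolding diagonalizable_def using N(1) nth_mem by metis
  also have "\<dots> \<longleftrightarrow>
    (\<forall>S. S \<subseteq> ?L \<and> S \<noteq> {} \<longrightarrow> (\<exists>e\<in>S. N e \<le> int (card (private_vertices T S e))))"
    using assms(5) by (intro ordering_iff_private finite_vertices finite_interior_l_edges)
  also have "\<dots> \<longleftrightarrow> (\<forall>S. S \<subseteq> ?L \<and> S \<noteq> {} \<longrightarrow>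
       (\<exists>e\<in>S. horizontal e \<and> int (card (private_vertices T S e)) \<ge> N_h d1 \<alpha>) \<or>
       (\<exists>e\<in>S. vertical e \<and> int (card (private_vertices T S e)) \<ge> N_v d2 \<beta>))"
    \<comment> \<open>The two existential statements merge into one over a disjunction, to which
      \<open>N(2)\<close> applies.\<close>
    using N(2) by (simp add: bex_disj_distrib[symmetric] subset_iff cong: bex_cong)
  finally show ?thesis .
qed

end
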